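(* For every $n\in\mathbb N$, the map $\varphi_2:SC_{7,n}\to SC_{7,4n+6}$ given by $$\varphi_2(-z,-y,-x,0,x,y,z)=(2y+1,\,-2x,\,2z+1,\,0,\,-2z-1,\,2x,\,-2y-1)$$ is a bijection.
   Context: $\mathbb N=\{0,1,2,\ldots\}$. A partition $\lambda$ is determined by its arm set $A^+(\lambda)=\{\lambda_i-i:1\le i\le s\}$ and leg set $L^+(\lambda)=\{\lambda^*_i-i:1\le i\le s\}$ ($s=\#\{i:\lambda_i\ge i\}$, $\lambda^*$ the conjugate); any two finite subsets of $\mathbb N$ of equal size are the leg and arm sets of a unique partition. For $c=(c_0,\ldots,c_{t-1})\in\mathbb Z^t$ with coordinate sum $0$, $\lambda_c$ is the partition with arm set $\{qt+j:0\le q<c_j\}$ and leg set $\{qt+t-j-1:0\le q<-c_j\}$. $SC_{t,n}$ is the set of such $c$ with $|\lambda_c|=n$ and $\lambda_c^*=\lambda_c$; elements of $SC_{7,n}$ have the form $(-z,-y,-x,0,x,y,z)$ with $x,y,z\in\mathbb Z$. *)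

theory Defs
  imports Main
begin

text \<open>A partition is the list of its positive parts in weakly decreasing order.\<close>

definition is_partition :: "nat list \<Rightarrow> bool" where
  "is_partition p \<longleftrightarrow> sorted_wrt (\<ge>) p \<and> (\<forall>k \<in> set p. 0 < k)"

text \<open>The part with 1-based index \<open>i\<close>, extended by zero beyond the length.\<close>

definition part_at :: "nat list \<Rightarrow> nat \<Rightarrow> nat" where
  "part_at p i = (if 1 \<le> i \<and> i \<le> length p then p ! (i - 1) else 0)"

definition conjugate :: "nat list \<Rightarrow> nat list" where
  "conjugate p = map (\<lambda>i. card {j. 1 \<le> j \<and> i \<le> part_at p j}) [1..<Suc (part_at p 1)]"

definition durfee :: "nat list \<Rightarrow> nat" where
  "durfee p = card {i. 1 \<le> i \<and> i \<le> part_at p i}"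

text \<open>For a partition the natural-number subtractions in the next two definitions do not
  truncate, because the parts in question of \<open>p\<close> and of its conjugate are at least \<open>i\<close>.\<close>

definition arm_set :: "nat list \<Rightarrow> nat set" where
  "arm_set p = {part_at p i - i |i. 1 \<le> i \<and> i \<le> durfee p}"

definition leg_set :: "nat list \<Rightarrow> nat set" where
  "leg_set p = {part_at (conjugate p) i - i |i. 1 \<le> i \<and> i \<le> durfee p}"

text \<open>The partition attached to an integer vector \<open>c\<close> with coordinate sum 0 and \<open>t\<close> entries,
  where \<open>t\<close> is the length of \<open>c\<close>.\<close>

definition partition_of :: "int list \<Rightarrow> nat list" where
  "partition_of c = (let t = length c in
     THE p. is_partition p
       \<and> arm_set p = {q * t + j |q j. j < t \<and> int q < c ! j}
       \<and> leg_set p = {q * t + t - j - 1 |q j. j < t \<and> int q < - (c ! j)})"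

definition SC :: "nat \<Rightarrow> nat \<Rightarrow> int list set" where
  "SC t n = {c. length c = t \<and> sum_list c = 0
     \<and> sum_list (partition_of c) = n \<and> conjugate (partition_of c) = partition_of c}"

text \<open>The entries 4, 5, 6 of a vector \<open>[-z, -y, -x, 0, x, y, z]\<close> are \<open>x\<close>, \<open>y\<close>, \<open>z\<close>.\<close>

definition phi2 :: "int list \<Rightarrow> int list" where
  "phi2 c = (let x = c ! 4; y = c ! 5; z = c ! 6 in
     [2 * y + 1, - 2 * x, 2 * z + 1, 0, - 2 * z - 1, 2 * x, - 2 * y - 1])"

lemma phi2_vector:
  "phi2 [- z, - y, - x, 0, x, y, z] =
     [2 * y + 1, - 2 * x, 2 * z + 1, 0, - 2 * z - 1, 2 * x, - 2 * y - 1]"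
  by (simp add: phi2_def Let_def)

end

theory Submission
  imports Defs
begin

text \<open>A nonempty partition arises from a smaller one by wrapping a hook around it, which adds the
  largest element to the arm set and to the leg set. Induction on the number of hooks shows that
  arm and leg sets determine the partition, that conjugation swaps them, and that the size is the
  sum of all arms and legs plus the number of hooks. Hence the self-conjugate vectors are exactly
  \<open>[-z, -y, -x, 0, x, y, z]\<close>, of size \<open>7 (x\<^sup>2 + y\<^sup>2 + z\<^sup>2) + 2 x + 4 y + 6 z\<close>. The map turns size \<open>n\<close>
  into \<open>4 n + 6\<close>, and reducing that size modulo 4 forces \<open>x\<close> and \<open>z\<close> odd and \<open>y\<close> even, so that every
  vector of size \<open>4 n + 6\<close> is in its image.\<close>

section \<open>Wrapping a hook around a partition\<close>

text \<open>A hook with arm \<open>a\<close> and leg \<open>l\<close> takes up the first row and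
  first column, and the diagram of \<open>r\<close> moves one step down the diagonal. Rows of the
  hook below \<open>r\<close> hold a single cell; the subtraction is exact once
  \<open>length r \<le> l\<close>.\<close>

definition wrap_hook :: "nat \<Rightarrow> nat \<Rightarrow> nat list \<Rightarrow> nat list" where
  "wrap_hook a l r = Suc a # map Suc r @ replicate (l - length r) 1"

lemma length_wrap_hook: "length r \<le> l \<Longrightarrow> length (wrap_hook a l r) = Suc l"
  by (simp add: wrap_hook_def)

lemma part_at_wrap_hook_1: "part_at (wrap_hook a l r) (Suc 0) = Suc a"
  by (simp add: wrap_hook_def part_at_def)

lemma part_at_wrap_hook_Suc:
  assumes "length r \<le> l" "1 \<le> i"
  shows "part_at (wrap_hook a l r) (Suc i) = (if i \<le> l then Suc (part_at r i) else 0)"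
  using assms by (auto simp: wrap_hook_def part_at_def nth_append nth_Cons')

lemma part_at_eq_0: "length p < i \<Longrightarrow> part_at p i = 0"
  by (simp add: part_at_def)

lemma part_at_le_first:
  assumes "is_partition p"
  shows "part_at p i \<le> part_at p 1"
proof (cases "1 < i \<and> i \<le> length p")
  case True
  then have "p ! (i - 1) \<le> p ! 0"
    using assms sorted_wrt_nth_less[of "(\<ge>)" p 0 "i - 1"] by (auto simp: is_partition_def)
  with True show ?thesis by (simp add: part_at_def)
qed (auto simp: part_at_def not_less le_Suc_eq)

lemma part_at_pos_iff:
  assumes "is_partition p" "1 \<le> i"
  shows "0 < part_at p i \<longleftrightarrow> i \<le> length p"
  using assms by (auto simp: part_at_def is_partition_def)

lemma is_partition_wrap_hook:
  assumes "is_partition r" "part_at r 1 \<le> a"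
  shows "is_partition (wrap_hook a l r)"
proof -
  have "x \<le> a" if "x \<in> set r" for x
  proof -
    from that obtain k where "k < length r" "r ! k = x" by (auto simp: in_set_conv_nth)
    then have "x = part_at r (Suc k)" by (simp add: part_at_def)
    then show ?thesis using part_at_le_first[OF assms(1), of "Suc k"] assms(2) by simp
  qed
  moreover have "sorted_wrt (\<ge>) (replicate k (1::nat))" for k
    by (induction k) auto
  ultimately show ?thesis using assms(1)
    by (auto simp: is_partition_def wrap_hook_def sorted_wrt_append sorted_wrt_map)
qed

lemma is_partition_Nil: "is_partition []"
  by (simp add: is_partition_def)

text \<open>Deleting the first column lowers every part by one; parts equal to 1 vanish, and being
  smallest they stand at the end.\<close>

lemma map_Suc_append_ones:
  assumes "sorted_wrt (\<ge>) p" "\<forall>k \<in> set p. 0 < k"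
  shows "\<exists>r m. is_partition r \<and> p = map Suc r @ replicate m (1::nat)"
  using assms
proof (induction p)
  case Nil
  then show ?case using is_partition_Nil by force
next
  case (Cons x p)
  then obtain r m where r: "is_partition r" "p = map Suc r @ replicate m 1" by auto
  show ?case
  proof (cases "x = 1")
    case True
    \<comment> \<open>After a head equal to 1 only ones can follow, so no part survives the
      deletion.\<close>
    have "r = []"
    proof (cases r)
      case (Cons y r')
      with r(2) have "Suc y \<in> set p" by simp
      with True Cons.prems(1) have "y = 0" by auto
      with r(1) Cons show ?thesis by (simp add: is_partition_def)
    qed
    with True r(2) have "x # p = map Suc [] @ replicate (Suc m) 1" by simp
    then show ?thesis using is_partition_Nil by blast
  next
    case False
    with Cons.prems obtain y where y: "x = Suc y" "0 < y" by (cases x) auto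
    have "k \<le> y" if "k \<in> set r" for k
    proof -
      have "Suc k \<in> set p" using that r(2) by simp
      then show ?thesis using Cons.prems(1) y(1) by auto
    qed
    with r(1) y(2) have "is_partition (y # r)" by (simp add: is_partition_def)
    moreover have "x # p = map Suc (y # r) @ replicate m 1" using r y by simp
    ultimately show ?thesis by blast
  qed
qed

lemma nonempty_partition_wrap_hook:
  assumes "is_partition p" "p \<noteq> []"
  obtains a l r where "is_partition r" "length r \<le> l" "part_at r 1 \<le> a" "p = wrap_hook a l r"
proof -
  from assms(2) obtain x q where p: "p = x # q" by (cases p) auto
  with assms(1) have q: "sorted_wrt (\<ge>) q" "\<forall>k \<in> set q. 0 < k" "0 < x" "\<forall>k \<in> set q. k \<le> x"
    by (auto simp: is_partition_def)
  from map_Suc_append_ones[OF q(1,2)] obtain r m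
    where r: "is_partition r" "q = map Suc r @ replicate m 1" by blast
  from q(3) obtain a where a: "x = Suc a" by (cases x) auto
  have "part_at r 1 \<le> a" using q(4) r(2) a by (cases r) (auto simp: part_at_def)
  moreover have "p = wrap_hook a (length r + m) r" using p a r(2) by (simp add: wrap_hook_def)
  ultimately show thesis using that r(1) le_add1 by blast
qed

text \<open>Stripping the outer hook shortens the list, so induction on length becomes induction on
  hooks. The two inequalities say that the hook reaches past \<open>r\<close> in both
  directions.\<close>

lemma partition_induct [consumes 1, case_names Nil wrap]:
  assumes "is_partition p" "P []"
    and "\<And>a l r. is_partition r \<Longrightarrow> length r \<le> l \<Longrightarrow> part_at r 1 \<le> a \<Longrightarrow> P r \<Longrightarrow> P (wrap_hook a l r)"
  shows "P p"
  using assms(1)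
proof (induction p rule: length_induct)
  case (1 p)
  show ?case
  proof (cases "p = []")
    case False
    then obtain a l r where r: "is_partition r" "length r \<le> l" "part_at r 1 \<le> a"
      "p = wrap_hook a l r" using nonempty_partition_wrap_hook 1(2) by metis
    then have "length r < length p" by (simp add: length_wrap_hook)
    with 1(1) r show ?thesis using assms(3) by blast
  qed (simp add: assms(2))
qed

section \<open>Conjugation, arm sets and leg sets\<close>

lemma length_conjugate: "length (conjugate p) = part_at p 1"
  by (simp add: conjugate_def)

lemma part_at_conjugate_1:
  assumes "is_partition p"
  shows "part_at (conjugate p) 1 = length p"
proof (cases "p = []")
  case True
  then show ?thesis by (simp add: conjugate_def part_at_def)
next
  case False
  then have "0 < part_at p 1" using part_at_pos_iff[OF assms, of 1] by (cases p) auto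
  moreover have "{j. 1 \<le> j \<and> 1 \<le> part_at p j} = {1..length p}"
    using part_at_pos_iff[OF assms] by (auto simp: Suc_le_eq)
  ultimately show ?thesis
    by (simp add: part_at_def[of "conjugate p"] length_conjugate)
       (simp add: conjugate_def nth_append del: upt_Suc)
qed

text \<open>Reflection in the diagonal swaps the arm and leg of the outer hook and reflects what
  lies inside. The proof compares column lengths: the first is \<open>Suc l\<close>, and each later
  one is one more than the preceding column of \<open>r\<close>.\<close>

lemma conjugate_wrap_hook:
  assumes "is_partition r" "length r \<le> l" "part_at r 1 \<le> a"
  shows "conjugate (wrap_hook a l r) = wrap_hook l a (conjugate r)"
proof -
  define f where "f p i = card {j. 1 \<le> j \<and> i \<le> part_at p j}" for p i
  have conj: "conjugate p = map (f p) [1..<Suc (part_at p 1)]" for p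
    by (simp add: conjugate_def f_def)
  let ?w = "wrap_hook a l r"
  have at: "part_at ?w j = (if j = 1 then Suc a else if j \<le> Suc l then Suc (part_at r (j - 1)) else 0)"
    if "1 \<le> j" for j
    using that part_at_wrap_hook_1 part_at_wrap_hook_Suc[OF assms(2), of "j - 1" a]
    by (cases "j = 1") auto
  have "{j. 1 \<le> j \<and> 1 \<le> part_at ?w j} = {1..Suc l}"
    using at by (auto split: if_splits)
  then have f1: "f ?w 1 = Suc l" by (simp add: f_def)
  have fS: "f ?w (Suc i) = Suc (f r i)" if "1 \<le> i" "i \<le> a" for i
  proof -
    have fin: "finite {j. 1 \<le> j \<and> i \<le> part_at r j}"
      by (rule finite_subset[of _ "{1..length r}"]) (use that in \<open>auto simp: part_at_def split: if_splits\<close>)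
    have le: "j \<le> l" if "i \<le> part_at r j" for j
      using that \<open>1 \<le> i\<close> assms(2) part_at_eq_0[of r j] by (cases "j \<le> l") auto
    have "{j. 1 \<le> j \<and> Suc i \<le> part_at ?w j} = insert 1 (Suc ` {j. 1 \<le> j \<and> i \<le> part_at r j})"
    proof (intro set_eqI iffI)
      fix j assume "j \<in> {j. 1 \<le> j \<and> Suc i \<le> part_at ?w j}"
      then show "j \<in> insert 1 (Suc ` {j. 1 \<le> j \<and> i \<le> part_at r j})"
        using at[of j] by (cases j) (auto split: if_splits)
    next
      fix j assume "j \<in> insert 1 (Suc ` {j. 1 \<le> j \<and> i \<le> part_at r j})"
      then show "j \<in> {j. 1 \<le> j \<and> Suc i \<le> part_at ?w j}"
        using at[of j] le that by auto
    qed
    moreover have "1 \<notin> Suc ` {j. 1 \<le> j \<and> i \<le> part_at r j}" by auto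
    ultimately show ?thesis using fin by (simp add: f_def card_image)
  qed
  have f0: "f r i = 0" if "part_at r 1 < i" for i
  proof -
    have "{j. 1 \<le> j \<and> i \<le> part_at r j} = {}"
      using le_less_trans[OF part_at_le_first[OF assms(1)] that] by (auto simp: not_le)
    then show ?thesis by (simp only: f_def card.empty)
  qed
  have "conjugate ?w = map (f ?w) (1 # map Suc [1..<Suc a])"
    unfolding conj by (simp add: part_at_wrap_hook_1 map_Suc_upt upt_conv_Cons del: upt_Suc)
  also have "\<dots> = Suc l # map (\<lambda>i. Suc (f r i)) [1..<Suc a]"
    using f1 fS by (auto simp del: upt_Suc)
  \<comment> \<open>Columns past the first part of \<open>r\<close> are empty in \<open>r\<close>,
    so there only the cell of the hook remains: these are the ones padding the conjugate.\<close>
  also have "[1..<Suc a] = [1..<Suc (part_at r 1)] @ [Suc (part_at r 1)..<Suc a]"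
    using assms(3) upt_add_eq_append[of 1 "Suc (part_at r 1)" "a - part_at r 1"] by simp
  also have "map (\<lambda>i. Suc (f r i)) \<dots> = map Suc (conjugate r) @
      map (\<lambda>i. 1) [Suc (part_at r 1)..<Suc a]"
    using f0 by (auto simp: conj simp del: upt_Suc)
  also have "map (\<lambda>i. 1::nat) [Suc (part_at r 1)..<Suc a] = replicate (a - length (conjugate r)) 1"
    by (simp add: map_replicate_const length_conjugate del: upt_Suc)
  finally show ?thesis by (simp add: wrap_hook_def)
qed

lemma conjugate_Nil: "conjugate [] = []"
  by (simp add: conjugate_def part_at_def)

lemma is_partition_conjugate:
  assumes "is_partition p"
  shows "is_partition (conjugate p)"
  using assms
proof (induction rule: partition_induct)
  case (wrap a l r)
  then show ?case
    using is_partition_wrap_hook[of "conjugate r" l a] part_at_conjugate_1[of r]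
    by (simp add: conjugate_wrap_hook)
qed (simp add: conjugate_Nil is_partition_Nil)

lemma conjugate_conjugate:
  assumes "is_partition p"
  shows "conjugate (conjugate p) = p"
  using assms
proof (induction rule: partition_induct)
  case (wrap a l r)
  then show ?case
    using part_at_conjugate_1[of r]
    by (simp add: conjugate_wrap_hook is_partition_conjugate length_conjugate)
qed (simp add: conjugate_Nil)

section \<open>Durfee size, arms and legs under wrapping\<close>

lemma durfee_set_subset: "{i. 1 \<le> i \<and> i \<le> part_at p i} \<subseteq> {1..length p}"
  by (auto simp: part_at_def split: if_splits)

lemma durfee_le_length: "durfee p \<le> length p"
  using card_mono[OF _ durfee_set_subset] by (simp add: durfee_def)

lemma durfee_wrap_hook:
  assumes "length r \<le> l"
  shows "durfee (wrap_hook a l r) = Suc (durfee r)"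
proof -
  let ?w = "wrap_hook a l r"
  have le: "j \<le> l" if "1 \<le> j" "j \<le> part_at r j" for j
    using that assms part_at_eq_0[of r j] by (cases "j \<le> l") auto
  have "i \<in> {i. 1 \<le> i \<and> i \<le> part_at ?w i} \<longleftrightarrow> i \<in> insert 1 (Suc ` {i. 1 \<le> i \<and> i \<le> part_at r i})" for i
  proof (cases "i \<le> 1")
    case True
    then show ?thesis using part_at_wrap_hook_1[of a l r] by (cases i) auto
  next
    case False
    then obtain k where "i = Suc k" "1 \<le> k" by (cases i) auto
    then show ?thesis using part_at_wrap_hook_Suc[OF assms, of k a] le[of k] by auto
  qed
  then have "{i. 1 \<le> i \<and> i \<le> part_at ?w i} = insert 1 (Suc ` {i. 1 \<le> i \<and> i \<le> part_at r i})"
    by blast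
  moreover have "1 \<notin> Suc ` {i. 1 \<le> i \<and> i \<le> part_at r i}" by auto
  moreover have "finite {i. 1 \<le> i \<and> i \<le> part_at r i}"
    using durfee_set_subset finite_subset by blast
  ultimately show ?thesis by (simp add: durfee_def card_image)
qed

text \<open>The diagonal shift raises row length and row index of \<open>r\<close> alike, so its
  arms are unchanged and only the arm of the new hook is added.\<close>

lemma arm_set_wrap_hook:
  assumes "length r \<le> l"
  shows "arm_set (wrap_hook a l r) = insert a (arm_set r)"
proof -
  have img: "arm_set p = (\<lambda>i. part_at p i - i) ` {1..durfee p}" for p
    by (auto simp: arm_set_def)
  have "{1..Suc (durfee r)} = insert 1 (Suc ` {1..durfee r})"
    by (auto simp: image_Suc_atLeastAtMost)
  then have "arm_set (wrap_hook a l r) =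
      insert a ((\<lambda>i. part_at (wrap_hook a l r) (Suc i) - Suc i) ` {1..durfee r})"
    by (simp add: img durfee_wrap_hook[OF assms] part_at_wrap_hook_1 image_image
        del: image_Suc_atLeastAtMost)
  also have "(\<lambda>i. part_at (wrap_hook a l r) (Suc i) - Suc i) ` {1..durfee r} = arm_set r"
    \<comment> \<open>The rows in question have index at most
      \<open>durfee r \<le> length r \<le> l\<close>, so the zero case of
      \<open>part_at_wrap_hook_Suc\<close> does not occur.\<close>
    unfolding img using durfee_le_length[of r] assms
    by (intro image_cong) (auto simp: part_at_wrap_hook_Suc)
  finally show ?thesis .
qed

lemma durfee_Nil: "durfee [] = 0"
  using durfee_le_length[of "[]"] by simp

lemma arm_set_Nil: "arm_set [] = {}"
  by (simp add: arm_set_def durfee_Nil)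

lemma durfee_conjugate:
  assumes "is_partition p"
  shows "durfee (conjugate p) = durfee p"
  using assms
proof (induction rule: partition_induct)
  case (wrap a l r)
  then show ?case
    by (simp add: conjugate_wrap_hook durfee_wrap_hook length_conjugate)
qed (simp add: conjugate_Nil)

text \<open>Both sets range over the same indices because conjugation keeps the Durfee size. Facts
  about arms thereby transfer to legs.\<close>

lemma leg_set_eq_arm_set_conjugate:
  "is_partition p \<Longrightarrow> leg_set p = arm_set (conjugate p)"
  by (simp add: leg_set_def arm_set_def durfee_conjugate)

lemma leg_set_conjugate:
  "is_partition p \<Longrightarrow> leg_set (conjugate p) = arm_set p"
  by (simp add: leg_set_eq_arm_set_conjugate is_partition_conjugate conjugate_conjugate)

lemma leg_set_Nil: "leg_set [] = {}"
  by (simp add: leg_set_def durfee_Nil)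

lemma leg_set_wrap_hook:
  assumes "is_partition r" "length r \<le> l" "part_at r 1 \<le> a"
  shows "leg_set (wrap_hook a l r) = insert l (leg_set r)"
  using assms
  by (simp add: leg_set_eq_arm_set_conjugate is_partition_wrap_hook conjugate_wrap_hook
      arm_set_wrap_hook length_conjugate)

section \<open>Size, uniqueness and existence from arm and leg sets\<close>

lemma finite_arm_set: "finite (arm_set p)"
  by (simp add: arm_set_def)

lemma finite_leg_set: "finite (leg_set p)"
  by (simp add: leg_set_def)

text \<open>The largest arm is the outermost one, one less than the first part. This makes the arm
  and leg of a wrapped hook strict maxima.\<close>

lemma arm_set_less_iff:
  assumes "is_partition p"
  shows "arm_set p \<subseteq> {..<a} \<longleftrightarrow> part_at p 1 \<le> a"
  using assms
proof (induction arbitrary: a rule: partition_induct)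
  case (wrap b l r)
  from wrap.IH[of b] wrap.hyps have "arm_set r \<subseteq> {..<b}" by simp
  with wrap.hyps show ?case
    by (force simp: arm_set_wrap_hook part_at_wrap_hook_1)
qed (simp add: arm_set_Nil part_at_def)

lemma leg_set_less_iff:
  assumes "is_partition p"
  shows "leg_set p \<subseteq> {..<l} \<longleftrightarrow> length p \<le> l"
  using arm_set_less_iff[OF is_partition_conjugate[OF assms]] part_at_conjugate_1[OF assms]
  by (simp add: leg_set_eq_arm_set_conjugate assms)

lemma wrap_hook_notin:
  assumes "is_partition r" "length r \<le> l" "part_at r 1 \<le> a"
  shows "a \<notin> arm_set r" "l \<notin> leg_set r"
  using arm_set_less_iff[OF assms(1), of a] leg_set_less_iff[OF assms(1), of l] assms by auto

text \<open>A hook with arm \<open>a\<close> and leg \<open>l\<close> has \<open>a + l + 1\<close>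
  cells, and the hooks tile the diagram. By \<open>wrap_hook_notin\<close> each wrapping adds new
  elements, so no term is lost in the sums over sets.\<close>

lemma sum_list_partition:
  assumes "is_partition p"
  shows "sum_list p = \<Sum>(arm_set p) + \<Sum>(leg_set p) + card (arm_set p)"
  using assms
proof (induction rule: partition_induct)
  case (wrap a l r)
  have "sum_list (map Suc r) = sum_list r + length r" by (induction r) auto
  then have "sum_list (wrap_hook a l r) = Suc (a + l + sum_list r)"
    using wrap.hyps by (simp add: wrap_hook_def sum_list_replicate)
  with wrap wrap_hook_notin[OF wrap.hyps] show ?case
    by (simp add: arm_set_wrap_hook leg_set_wrap_hook finite_arm_set finite_leg_set)
qed (simp add: arm_set_Nil leg_set_Nil)

lemma insert_upper_bound_eqD:
  fixes a b :: "'a :: linorder"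
  assumes "insert a A = insert b B" "A \<subseteq> {..<a}" "B \<subseteq> {..<b}"
  shows "a = b \<and> A = B"
proof -
  have "a = b" using assms by (metis insert_iff lessThan_iff less_asym subset_iff)
  moreover from this have "a \<notin> A" "b \<notin> B" using assms by auto
  ultimately show ?thesis using assms(1) insert_ident by metis
qed

text \<open>The outermost hook can be read off as the maxima of the two sets; removing it leaves the
  data of the inner partition.\<close>

lemma partition_eqI:
  assumes "is_partition p" "is_partition q" "arm_set q = arm_set p" "leg_set q = leg_set p"
  shows "q = p"
  using assms
proof (induction arbitrary: q rule: partition_induct)
  case Nil
  then show ?case
    by (metis arm_set_Nil arm_set_wrap_hook insert_not_empty nonempty_partition_wrap_hook)
next
  case (wrap a l r)
  have "q \<noteq> []" using wrap.prems wrap.hyps by (auto simp: arm_set_wrap_hook arm_set_Nil)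
  then obtain a' l' r' where r': "is_partition r'" "length r' \<le> l'" "part_at r' 1 \<le> a'"
    "q = wrap_hook a' l' r'" using nonempty_partition_wrap_hook wrap.prems(1) by metis
  have "a' = a \<and> arm_set r' = arm_set r"
    using insert_upper_bound_eqD[of a' "arm_set r'" a "arm_set r"] wrap.prems wrap.hyps r'
    by (simp add: arm_set_wrap_hook arm_set_less_iff)
  moreover have "l' = l \<and> leg_set r' = leg_set r"
    using insert_upper_bound_eqD[of l' "leg_set r'" l "leg_set r"] wrap.prems wrap.hyps r'
    by (simp add: leg_set_wrap_hook leg_set_less_iff)
  ultimately show ?case using wrap.IH[of r'] r' by simp
qed

text \<open>The maxima serve as arm and leg of the outermost hook, and the remaining elements give
  the inner partition by induction.\<close>

lemma partition_exists:
  assumes "finite A" "finite B" "card A = card B"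
  shows "\<exists>p. is_partition p \<and> arm_set p = A \<and> leg_set p = B"
  using assms
proof (induction "card A" arbitrary: A B)
  case 0
  then have "A = {}" "B = {}" by auto
  then show ?case using is_partition_Nil arm_set_Nil leg_set_Nil by blast
next
  case (Suc n)
  define a l where "a = Max A" and "l = Max B"
  from Suc have ne: "A \<noteq> {}" "B \<noteq> {}" by auto
  then have mem: "a \<in> A" "l \<in> B" using Suc.prems by (auto simp: a_def l_def)
  have "n = card (A - {a})" "card (A - {a}) = card (B - {l})" using Suc mem by auto
  then obtain r where r: "is_partition r" "arm_set r = A - {a}" "leg_set r = B - {l}"
    using Suc.hyps(1)[of "A - {a}" "B - {l}"] Suc.prems by auto
  have "A - {a} \<subseteq> {..<a}" "B - {l} \<subseteq> {..<l}"
    using Suc.prems by (auto simp: a_def l_def order.strict_iff_order)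
  then have le: "part_at r 1 \<le> a" "length r \<le> l"
    using arm_set_less_iff[of r] leg_set_less_iff[of r] r by auto
  have "arm_set (wrap_hook a l r) = A" "leg_set (wrap_hook a l r) = B"
    using r le mem by (auto simp: arm_set_wrap_hook leg_set_wrap_hook)
  with is_partition_wrap_hook[OF r(1) le(1)] show ?case by blast
qed

lemma conjugate_eq_self_iff:
  assumes "is_partition p"
  shows "conjugate p = p \<longleftrightarrow> arm_set p = leg_set p"
  using partition_eqI[OF assms is_partition_conjugate[OF assms]]
    leg_set_eq_arm_set_conjugate[OF assms] leg_set_conjugate[OF assms] by metis

section \<open>The partition attached to an integer vector\<close>

text \<open>An abacus with one runner per residue: runner \<open>j\<close> carries beads on its
  first \<open>c ! j\<close> positions, and none if \<open>c ! j\<close> is not positive.\<close>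

definition vector_arms :: "int list \<Rightarrow> nat set" where
  "vector_arms c = {q * length c + j |q j. j < length c \<and> int q < c ! j}"

text \<open>Replacing \<open>j\<close> by \<open>t - 1 - j\<close> turns legs into arms of the
  reversed, negated vector, so one set of lemmas serves both.\<close>

lemma vector_legs:
  "{q * length c + length c - j - 1 |q j. j < length c \<and> int q < - (c ! j)} =
    vector_arms (map uminus (rev c))" (is "?L = ?R")
proof (intro set_eqI iffI)
  let ?t = "length c"
  fix x
  assume "x \<in> ?L"
  then obtain q j where "j < ?t" "int q < - (c ! j)" "x = q * ?t + ?t - j - 1" by blast
  then have "?t - Suc j < ?t" "int q < map uminus (rev c) ! (?t - Suc j)"
    "x = q * ?t + (?t - Suc j)" by (auto simp: rev_nth)
  then show "x \<in> ?R" unfolding vector_arms_def by (simp del: nth_map) blast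
next
  let ?t = "length c"
  fix x
  assume "x \<in> ?R"
  then obtain q j where "j < ?t" "int q < map uminus (rev c) ! j" "x = q * ?t + j"
    unfolding vector_arms_def by auto
  then have "?t - Suc j < ?t" "int q < - (c ! (?t - Suc j))"
    "x = q * ?t + ?t - (?t - Suc j) - 1" by (auto simp: rev_nth)
  then show "x \<in> ?L" by blast
qed

lemma vector_arms_eq_UN:
  "vector_arms c = (\<Union>j<length c. (\<lambda>q. q * length c + j) ` {..<nat (c ! j)})"
  by (fastforce simp: vector_arms_def zless_nat_eq_int_zless)

lemma finite_vector_arms: "finite (vector_arms c)"
  by (simp add: vector_arms_eq_UN)

lemma mem_vector_arms_iff:
  assumes "j < length c"
  shows "q * length c + j \<in> vector_arms c \<longleftrightarrow> int q < c ! j"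
proof
  assume "q * length c + j \<in> vector_arms c"
  then obtain q' j' where *: "q * length c + j = q' * length c + j'" "j' < length c"
    "int q' < c ! j'" by (auto simp: vector_arms_def)
  from *(1) have "(q * length c + j) mod length c = (q' * length c + j') mod length c"
    by (simp only:)
  with *(2) assms have "j = j'" by simp
  with *(1) assms have "q = q'" by auto
  with *(3) \<open>j = j'\<close> show "int q < c ! j" by simp
qed (use assms in \<open>auto simp: vector_arms_def\<close>)

lemma sum_vector_arms:
  fixes f :: "nat \<Rightarrow> 'a :: comm_monoid_add"
  shows "sum f (vector_arms c) = (\<Sum>j<length c. \<Sum>q<nat (c ! j). f (q * length c + j))"
proof -
  have "sum f (vector_arms c) =
      (\<Sum>j<length c. sum f ((\<lambda>q. q * length c + j) ` {..<nat (c ! j)}))"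
    unfolding vector_arms_eq_UN
  proof (rule sum.UNION_disjoint, simp_all, intro ballI impI)
    \<comment> \<open>Distinct runners are disjoint because their elements have distinct residues
      modulo the length.\<close>
    fix i j assume "i \<in> {..<length c}" "j \<in> {..<length c}" "i \<noteq> j"
    then have "(q * length c + i) mod length c \<noteq> (q' * length c + j) mod length c" for q q'
      by simp
    then have "q * length c + i \<noteq> q' * length c + j" for q q' by metis
    then show "(\<lambda>q. q * length c + i) ` {..<nat (c ! i)} \<inter>
      (\<lambda>q. q * length c + j) ` {..<nat (c ! j)} = {}" by blast
  qed
  also have "\<dots> = (\<Sum>j<length c. \<Sum>q<nat (c ! j). f (q * length c + j))"
    by (rule sum.cong[OF refl], subst sum.reindex) (auto simp: inj_on_def)
  finally show ?thesis .
qed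

lemma card_vector_arms: "card (vector_arms c) = (\<Sum>j<length c. nat (c ! j))"
  using sum_vector_arms[of "\<lambda>_. 1::nat" c] by simp

text \<open>Since \<open>nat x - nat (- x) = x\<close> over the integers, the numbers of arms and
  legs differ by the coordinate sum, which is zero.\<close>

lemma card_vector_legs:
  assumes "sum_list c = 0"
  shows "card (vector_arms (map uminus (rev c))) = card (vector_arms c)"
proof -
  have "card (vector_arms (map uminus (rev c))) = (\<Sum>j<length c. nat (- (c ! (length c - Suc j))))"
    by (simp add: card_vector_arms rev_nth)
  also have "\<dots> = (\<Sum>j<length c. nat (- (c ! j)))"
    by (rule sum.nat_diff_reindex)
  finally have legs: "card (vector_arms (map uminus (rev c))) = (\<Sum>j<length c. nat (- (c ! j)))" .
  have "(\<Sum>j<length c. int (nat (c ! j)) - int (nat (- (c ! j)))) = (\<Sum>j<length c. c ! j)"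
    by (intro sum.cong) auto
  also have "\<dots> = 0" using assms by (simp add: sum_list_sum_nth atLeast0LessThan)
  finally have "int (\<Sum>j<length c. nat (c ! j)) = int (\<Sum>j<length c. nat (- (c ! j)))"
    by (simp only: sum_subtractf of_nat_sum)
  then show ?thesis unfolding legs card_vector_arms[of c] by linarith
qed

text \<open>Existence and uniqueness show that the definite description in
  \<open>partition_of\<close> denotes the intended partition.\<close>

lemma partition_of_props:
  assumes "sum_list c = 0"
  shows "is_partition (partition_of c)" "arm_set (partition_of c) = vector_arms c"
    "leg_set (partition_of c) = vector_arms (map uminus (rev c))"
proof -
  let ?P = "\<lambda>p. is_partition p \<and> arm_set p = vector_arms c
    \<and> leg_set p = vector_arms (map uminus (rev c))"
  have "\<exists>!p. ?P p"
    using partition_exists[of "vector_arms c" "vector_arms (map uminus (rev c))"]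
      partition_eqI card_vector_legs[OF assms] finite_vector_arms by metis
  moreover have "partition_of c = (THE p. ?P p)"
    unfolding partition_of_def Let_def vector_legs by (simp add: vector_arms_def)
  ultimately have "?P (partition_of c)" using theI'[of ?P] by simp
  then show "is_partition (partition_of c)" "arm_set (partition_of c) = vector_arms c"
    "leg_set (partition_of c) = vector_arms (map uminus (rev c))" by auto
qed

section \<open>Self-conjugate vectors and their sizes\<close>

lemma vector_arms_eqD:
  assumes "vector_arms c = vector_arms d" "length c = length d" "j < length c"
  shows "nat (c ! j) = nat (d ! j)"
proof -
  have "int q < c ! j \<longleftrightarrow> int q < d ! j" for q
    using mem_vector_arms_iff[of j c q] mem_vector_arms_iff[of j d q] assms by simp
  \<comment> \<open>Testing the first free position on either runner gives one inequality each
    way.\<close>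
  from this[of "nat (c ! j)"] this[of "nat (d ! j)"] show ?thesis by linarith
qed

lemma self_conjugate_vector_iff:
  assumes "sum_list c = 0"
  shows "conjugate (partition_of c) = partition_of c \<longleftrightarrow> c = map uminus (rev c)"
proof
  assume "conjugate (partition_of c) = partition_of c"
  then have eq: "vector_arms c = vector_arms (map uminus (rev c))"
    using conjugate_eq_self_iff partition_of_props[OF assms] by simp
  show "c = map uminus (rev c)"
  proof (rule nth_equalityI)
    fix j assume j: "j < length c"
    \<comment> \<open>Arm sets see only positive parts of coordinates. Comparing at \<open>j\<close>
      gives the positive parts, and at the mirror index the negative parts, of the two numbers to be
      identified.\<close>
    have "nat (c ! j) = nat (- (c ! (length c - Suc j)))"
      using vector_arms_eqD[OF eq _ j] j by (simp add: rev_nth)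
    moreover have "nat (c ! (length c - Suc j)) = nat (- (c ! j))"
      using vector_arms_eqD[OF eq, of "length c - Suc j"] j by (simp add: rev_nth)
    ultimately show "c ! j = map uminus (rev c) ! j" using j by (simp add: rev_nth)
  qed simp
next
  assume "c = map uminus (rev c)"
  then show "conjugate (partition_of c) = partition_of c"
    using conjugate_eq_self_iff partition_of_props[OF assms] by simp
qed

text \<open>A hook with arm and leg both \<open>v\<close> has \<open>2 * v + 1\<close> cells; this
  is the total over the first \<open>m\<close> positions of runner \<open>j\<close>.\<close>

lemma sum_arithmetic_progression:
  "2 * (\<Sum>q<m. int (q * t + j)) + int m = int t * (int m)\<^sup>2 + (2 * int j + 1 - int t) * int m"
  by (induction m) (simp_all add: algebra_simps power2_eq_square)

lemma self_conjugate_size: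
  assumes "sum_list c = 0" "c = map uminus (rev c)"
  shows "int (sum_list (partition_of c)) =
    (\<Sum>j<length c. int (length c) * (int (nat (c ! j)))\<^sup>2
      + (2 * int j + 1 - int (length c)) * int (nat (c ! j)))"
proof -
  have "leg_set (partition_of c) = vector_arms c"
    using partition_of_props(3)[OF assms(1)] assms(2) by simp
  then have "int (sum_list (partition_of c)) = 2 * (\<Sum>x\<in>vector_arms c. int x) + int (card (vector_arms c))"
    using sum_list_partition partition_of_props[OF assms(1)] by simp
  also have "\<dots> = (\<Sum>j<length c. 2 * (\<Sum>q<nat (c ! j). int (q * length c + j)) + int (nat (c ! j)))"
    by (simp only: sum_vector_arms card_vector_arms of_nat_sum sum.distrib sum_distrib_left)
  finally show ?thesis by (simp only: sum_arithmetic_progression)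
qed

section \<open>The case of seven coordinates\<close>

lemma list_of_length_7:
  "length c = 7 \<Longrightarrow> c = [c ! 0, c ! 1, c ! 2, c ! 3, c ! 4, c ! 5, c ! 6]"
  by (auto simp: list_eq_iff_nth_eq numeral_eq_Suc All_less_Suc)

lemma square_pos_neg_parts:
  "7 * (int (nat x))\<^sup>2 + 7 * (int (nat (- x)))\<^sup>2 = 7 * x\<^sup>2"
  by (cases "0 \<le> x") auto

text \<open>For \<open>t = 7\<close> the linear coefficient at index \<open>j\<close> is
  \<open>2 * j - 6\<close>, which changes sign under the mirror \<open>j\<close> to
  \<open>6 - j\<close>. Hence positive and negative parts of each of \<open>x\<close>,
  \<open>y\<close>, \<open>z\<close> recombine.\<close>

lemma size_self_conjugate_7:
  "int (sum_list (partition_of [- z, - y, - x, 0, x, y, z])) =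
    7 * (x\<^sup>2 + y\<^sup>2 + z\<^sup>2) + 2 * x + 4 * y + 6 * z"
proof -
  have "{..<7::nat} = {0, 1, 2, 3, 4, 5, 6}" by auto
  then have "int (sum_list (partition_of [- z, - y, - x, 0, x, y, z])) =
     (7 * (int (nat x))\<^sup>2 + 7 * (int (nat (- x)))\<^sup>2)
   + (7 * (int (nat y))\<^sup>2 + 7 * (int (nat (- y)))\<^sup>2)
   + (7 * (int (nat z))\<^sup>2 + 7 * (int (nat (- z)))\<^sup>2)
   + 2 * (int (nat x) - int (nat (- x))) + 4 * (int (nat y) - int (nat (- y)))
   + 6 * (int (nat z) - int (nat (- z)))"
    by (subst self_conjugate_size) (simp_all del: int_nat_eq)
  moreover have "int (nat w) - int (nat (- w)) = w" for w by simp
  ultimately show ?thesis by (simp only: square_pos_neg_parts) (simp add: algebra_simps)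
qed

lemma SC_7_eq:
  "SC 7 n = {[- z, - y, - x, 0, x, y, z] |x y z.
    7 * (x\<^sup>2 + y\<^sup>2 + z\<^sup>2) + 2 * x + 4 * y + 6 * z = int n}" (is "_ = ?R")
proof (intro set_eqI iffI)
  fix c assume "c \<in> SC 7 n"
  then have c: "length c = 7" "sum_list c = 0" "sum_list (partition_of c) = n"
    "c = map uminus (rev c)" using self_conjugate_vector_iff by (auto simp: SC_def)
  \<comment> \<open>At \<open>j = 3\<close> this forces the middle coordinate to be zero.\<close>
  have neg: "c ! j = - (c ! (6 - j))" if "j < 7" for j
    using arg_cong[OF c(4), of "\<lambda>d. d ! j"] that c(1) by (simp add: rev_nth)
  have "c = [- (c ! 6), - (c ! 5), - (c ! 4), 0, c ! 4, c ! 5, c ! 6]"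
    by (subst list_of_length_7[OF c(1)]) (use neg[of 0] neg[of 1] neg[of 2] neg[of 3] in simp)
  moreover from this have "7 * ((c ! 4)\<^sup>2 + (c ! 5)\<^sup>2 + (c ! 6)\<^sup>2) + 2 * c ! 4 + 4 * c ! 5 + 6 * c ! 6 = int n"
    using c(3) size_self_conjugate_7[of "c ! 6" "c ! 5" "c ! 4"] by metis
  ultimately show "c \<in> ?R" by blast
next
  fix c assume "c \<in> ?R"
  then obtain x y z where c: "c = [- z, - y, - x, 0, x, y, z]"
    "7 * (x\<^sup>2 + y\<^sup>2 + z\<^sup>2) + 2 * x + 4 * y + 6 * z = int n" by blast
  then have "sum_list c = 0" "length c = 7" "c = map uminus (rev c)" by simp_all
  moreover have "int (sum_list (partition_of c)) = int n"
    using c size_self_conjugate_7 by simp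
  ultimately show "c \<in> SC 7 n" using self_conjugate_vector_iff by (simp add: SC_def)
qed

section \<open>Residues modulo 4 and the bijection\<close>

lemma parity_of_solution:
  fixes x y z m :: int
  assumes "7 * (x\<^sup>2 + y\<^sup>2 + z\<^sup>2) + 2 * x + 4 * y + 6 * z = 4 * m + 6"
  shows "odd x \<and> even y \<and> odd z"
proof -
  have "\<exists>a d. w = 2 * a + d \<and> d \<in> {0, 1}" for w :: int
    by (rule exI[of _ "w div 2"], rule exI[of _ "w mod 2"]) auto
  then obtain a b c d e f where "x = 2 * a + d" "y = 2 * b + e" "z = 2 * c + f"
    "d \<in> {0, 1}" "e \<in> {0, 1}" "f \<in> {0, 1}"
    by metis
  \<comment> \<open>\<open>k\<close> collects all multiples of 4. For bits \<open>d\<close>,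
    \<open>e\<close>, \<open>f\<close> what remains is \<open>d - e + f\<close> congruent to 2
    modulo 4, and that difference lies between -1 and 2.\<close>
  moreover define k where
    "k = 7 * (a\<^sup>2 + a * d + b\<^sup>2 + b * e + c\<^sup>2 + c * f) + a + 2 * b + 3 * c - m"
  ultimately have "4 * k + 7 * (d\<^sup>2 + e\<^sup>2 + f\<^sup>2) + 2 * d + 4 * e + 6 * f = 6"
    using assms by (simp add: power2_eq_square algebra_simps)
  with \<open>d \<in> _\<close> \<open>e \<in> _\<close> \<open>f \<in> _\<close> have "d = 1 \<and> e = 0 \<and> f = 1"
    by (elim insertE emptyE; simp; presburger)
  with \<open>x = _\<close> \<open>y = _\<close> \<open>z = _\<close> show ?thesis by simp
qed

theorem theorem5p12:
  fixes n :: nat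
  shows "bij_betw phi2 (SC 7 n) (SC 7 (4 * n + 6))"
proof (rule bij_betw_imageI)
  show "inj_on phi2 (SC 7 n)"
    by (auto simp: inj_on_def SC_7_eq phi2_vector)
  show "phi2 ` SC 7 n = SC 7 (4 * n + 6)"
  proof (intro set_eqI iffI)
    fix d assume "d \<in> phi2 ` SC 7 n"
    then obtain x y z where d: "d = phi2 [- z, - y, - x, 0, x, y, z]"
      "7 * (x\<^sup>2 + y\<^sup>2 + z\<^sup>2) + 2 * x + 4 * y + 6 * z = int n" by (auto simp: SC_7_eq)
    \<comment> \<open>These are entries 4, 5 and 6 of the image. Completing the expansion turns the
      size form with value \<open>n\<close> into \<open>4 * n + 6\<close>.\<close>
    let ?x = "- 2 * z - 1" and ?y = "2 * x" and ?z = "- 2 * y - 1"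
    have "d = [- ?z, - ?y, - ?x, 0, ?x, ?y, ?z]" unfolding d(1) phi2_vector by simp
    moreover have "7 * (?x\<^sup>2 + ?y\<^sup>2 + ?z\<^sup>2) + 2 * ?x + 4 * ?y + 6 * ?z = int (4 * n + 6)"
      using d(2) by (simp add: power2_eq_square algebra_simps)
    ultimately show "d \<in> SC 7 (4 * n + 6)" unfolding SC_7_eq by blast
  next
    fix d assume "d \<in> SC 7 (4 * n + 6)"
    then obtain u v w where d: "d = [- w, - v, - u, 0, u, v, w]"
      "7 * (u\<^sup>2 + v\<^sup>2 + w\<^sup>2) + 2 * u + 4 * v + 6 * w = 4 * int n + 6" by (auto simp: SC_7_eq)
    \<comment> \<open>These parities are exactly what is needed to solve the defining equations of
      \<open>phi2\<close> for integers \<open>x\<close>, \<open>y\<close>, \<open>z\<close>.\<close>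
    from parity_of_solution[OF d(2)] have "even (- u - 1)" "even v" "even (- w - 1)" by simp_all
    then obtain x y z where "- u - 1 = 2 * z" "v = 2 * x" "- w - 1 = 2 * y" by (elim evenE)
    then have s: "u = - 2 * z - 1" "v = 2 * x" "w = - 2 * y - 1" by simp_all
    have "d = phi2 [- z, - y, - x, 0, x, y, z]" unfolding d(1) phi2_vector s by simp
    moreover have "7 * (x\<^sup>2 + y\<^sup>2 + z\<^sup>2) + 2 * x + 4 * y + 6 * z = int n"
      using d(2) unfolding s by (simp add: power2_eq_square algebra_simps)
    ultimately show "d \<in> phi2 ` SC 7 n" unfolding SC_7_eq by blast
  qed
qed

end
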